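(* For a zero-dimensional set $X$ of real numbers, the following are equivalent: (1) $X$ satisfies $\mathsf{U}_{fin}(\mathcal{O},\mathrm{T}^* )$; (2) every continuous image of $X$ in $\mathbb{N}^\mathbb{N}$ satisfies the weak excluded middle property.
   Context: All spaces $X$ are infinite sets of reals; all covers are assumed not to contain $X$ as a member. A cover is large if each point lies in infinitely many members. $[\mathbb{N}]^\infty$ is the space of infinite subsets of $\mathbb{N}$; $a\subseteq^*b$ means $a\setminus b$ finite. $Y\subseteq[\mathbb{N}]^\infty$ is linearly refinable if for each $y\in Y$ there is an infinite $\hat y\subseteq y$ such that $\{\hat y:y\in Y\}$ is linearly quasiordered by $\subseteq^*$. For a countable cover enumerated bijectively as $\mathcal{U}=\{U_n:n\in\mathbb{N}\}$, $h_\mathcal{U}(x)=\{n:x\in U_n\}$. A cover $\mathcal{U}$ is a $\tau^*$-cover if it is large and $h_\mathcal{U}[X]$ is linearly refinable. $\mathcal{O}$ is the collection of countable open covers of $X$ and $\mathrm{T}^*$ the collection of countable open $\tau^*$-covers. $X$ satisfies $\mathsf{U}_{fin}(\mathcal{O},\mathrm{T}^* )$ if for every sequence $(\mathcal{U}_n)$ of members of $\mathcal{O}$ none of which contains a finite subcover, there are finite (possibly empty) $\mathcal{F}_n\subseteq\mathcal{U}_n$ with $\{\bigcup\mathcal{F}_n:n\in\mathbb{N}\}\in\mathrm{T}^*$. For $f,h\in\mathbb{N}^\mathbb{N}$, $[f\le h]=\{n:f(n)\le h(n)\}$. $Y\subseteq\mathbb{N}^\mathbb{N}$ satisfies the weak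 excluded middle property if there is $h\in\mathbb{N}^\mathbb{N}$ such that each $[f\le h]$, $f\in Y$, is infinite and the collection $\{[f\le h]:f\in Y\}$ is linearly refinable. *)

theory Defs
  imports "HOL-Analysis.Analysis"
begin

definition almost_subset :: "'a set \<Rightarrow> 'a set \<Rightarrow> bool"  (infix "\<subseteq>*" 50)
  where "a \<subseteq>* b \<longleftrightarrow> finite (a - b)"

(* The relation is always reflexive and transitive, so a family is linearly quasiordered by it
   as soon as any two members are comparable. *)
definition linearly_quasiordered :: "nat set set \<Rightarrow> bool"
  where "linearly_quasiordered Y \<longleftrightarrow> (\<forall>a\<in>Y. \<forall>b\<in>Y. a \<subseteq>* b \<or> b \<subseteq>* a)"

(* The notion concerns families of infinite sets; the first conjunct records this. *)
definition linearly_refinable :: "nat set set \<Rightarrow> bool"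
  where "linearly_refinable Y \<longleftrightarrow>
    (\<forall>y\<in>Y. infinite y) \<and>
    (\<exists>r. (\<forall>y\<in>Y. r y \<subseteq> y \<and> infinite (r y)) \<and> linearly_quasiordered (r ` Y))"

definition cover_of :: "'a set \<Rightarrow> 'a set set \<Rightarrow> bool"
  where "cover_of X \<U> \<longleftrightarrow> (\<forall>U\<in>\<U>. U \<subseteq> X) \<and> \<Union>\<U> = X \<and> X \<notin> \<U>"

definition large_cover_of :: "'a set \<Rightarrow> 'a set set \<Rightarrow> bool"
  where "large_cover_of X \<U> \<longleftrightarrow> cover_of X \<U> \<and> (\<forall>x\<in>X. infinite {U \<in> \<U>. x \<in> U})"

definition point_trace :: "(nat \<Rightarrow> 'a set) \<Rightarrow> 'a \<Rightarrow> nat set"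
  where "point_trace e x = {n. x \<in> e n}"

(* A cover satisfying this is countable, being enumerated bijectively by the naturals.  The
   choice of the enumeration is immaterial: another one changes the traces by a permutation
   of the naturals, which preserves linear refinability. *)
definition tau_star_cover_of :: "'a set \<Rightarrow> 'a set set \<Rightarrow> bool"
  where "tau_star_cover_of X \<U> \<longleftrightarrow>
    large_cover_of X \<U> \<and>
    (\<exists>e. bij_betw e (UNIV :: nat set) \<U> \<and> linearly_refinable (point_trace e ` X))"

definition countable_open_covers :: "'a::topological_space set \<Rightarrow> 'a set set set"
  where "countable_open_covers X =
    {\<U>. cover_of X \<U> \<and> countable \<U> \<and> (\<forall>U\<in>\<U>. openin (top_of_set X) U)}"

definition countable_open_tau_star_covers :: "'a::topological_space set \<Rightarrow> 'a set set set"
  where "countable_open_tau_star_covers X =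
    {\<U>. tau_star_cover_of X \<U> \<and> countable \<U> \<and> (\<forall>U\<in>\<U>. openin (top_of_set X) U)}"

definition Ufin_O_tau_star :: "'a::topological_space set \<Rightarrow> bool"
  where "Ufin_O_tau_star X \<longleftrightarrow>
    (\<forall>\<U> :: nat \<Rightarrow> 'a set set.
      (\<forall>n. \<U> n \<in> countable_open_covers X) \<and>
      (\<forall>n. \<not> (\<exists>\<G>. finite \<G> \<and> \<G> \<subseteq> \<U> n \<and> \<Union>\<G> = X)) \<longrightarrow>
      (\<exists>\<F>. (\<forall>n. finite (\<F> n) \<and> \<F> n \<subseteq> \<U> n) \<and>
        range (\<lambda>n. \<Union>(\<F> n)) \<in> countable_open_tau_star_covers X))"

definition weak_excluded_middle :: "(nat \<Rightarrow> nat) set \<Rightarrow> bool"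
  where "weak_excluded_middle Y \<longleftrightarrow>
    (\<exists>h. (\<forall>f\<in>Y. infinite {n. f n \<le> h n}) \<and>
         linearly_refinable ((\<lambda>f. {n. f n \<le> h n}) ` Y))"

(* The library's small inductive dimension renders "zero-dimensional": for nonempty X,
   dimension at most 0 is dimension 0, which says that clopen sets form a base. *)
lemma dim_le_0_iff_clopen_base:
  "top_of_set X dim_le 0 \<longleftrightarrow>
    (\<forall>U x. openin (top_of_set X) U \<and> x \<in> U \<longrightarrow>
      (\<exists>V. openin (top_of_set X) V \<and> closedin (top_of_set X) V \<and> x \<in> V \<and> V \<subseteq> U))"
  unfolding dimension_le_0_neighbourhood_base_of_clopen
  by (subst open_neighbourhood_base_of) blast+

end

theory Submission
  imports Defs
begin

text \<open>
  A continuous map \<open>\<Psi>\<close> into the Baire space corresponds to the sequence of increasing covers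
  \<open>{x. \<Psi> x n \<le> m}\<close> (\<open>m\<close> a natural number), and conversely a sequence of open covers of a
  zero-dimensional set is refined by countable clopen covers \<open>C n\<close>, which yield the continuous map
  sending \<open>x\<close> to the sequence of least indices \<open>k\<close> with \<open>x \<in> C n k\<close>. A function \<open>h\<close> is then the
  same as a choice of finite subfamilies, and \<open>{n. \<Psi> x n \<le> h n}\<close> is the trace of \<open>x\<close>. To obtain
  a cover that is enumerated bijectively, each finite subfamily is enlarged so that its union is
  not contained in any of the earlier unions; enlarging the traces does no harm. If infinitely many
  coordinates of \<open>\<Psi>\<close> are bounded, so that their covers have finite subcovers, then an \<open>h\<close> above
  these bounds makes all traces contain a common infinite set; otherwise the finitely many bounded
  coordinates can be dropped.
\<close>

section \<open>Refinements indexed by points\<close>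

text \<open>Lets refinements be chosen per point, so that points with the same trace may get
  different ones. Conversely, \<open>inv_into\<close> selects one representative point for each
  trace, and its refinement is used.\<close>

lemma linearly_refinable_image_iff:
  "linearly_refinable (g ` X) \<longleftrightarrow>
    (\<exists>s. (\<forall>x\<in>X. s x \<subseteq> g x \<and> infinite (s x)) \<and> linearly_quasiordered (s ` X))"
proof
  assume "linearly_refinable (g ` X)"
  then obtain r where "\<forall>y\<in>g ` X. r y \<subseteq> y \<and> infinite (r y)" "linearly_quasiordered (r ` g ` X)"
    unfolding linearly_refinable_def by blast
  then show "\<exists>s. (\<forall>x\<in>X. s x \<subseteq> g x \<and> infinite (s x)) \<and> linearly_quasiordered (s ` X)"
    by (intro exI[of _ "r \<circ> g"]) (auto simp: image_comp)
next
  assume "\<exists>s. (\<forall>x\<in>X. s x \<subseteq> g x \<and> infinite (s x)) \<and> linearly_quasiordered (s ` X)"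
  then obtain s where s: "\<And>x. x \<in> X \<Longrightarrow> s x \<subseteq> g x \<and> infinite (s x)"
    and lin: "linearly_quasiordered (s ` X)" by blast
  define r where "r = s \<circ> inv_into X g"
  have inv: "inv_into X g y \<in> X" "g (inv_into X g y) = y" if "y \<in> g ` X" for y
    using that by (auto simp: inv_into_into f_inv_into_f)
  have r: "r y \<subseteq> y \<and> infinite (r y)" if "y \<in> g ` X" for y
    using s[OF inv(1)[OF that]] inv(2)[OF that] by (simp add: r_def)
  moreover have "linearly_quasiordered (r ` g ` X)"
    using lin inv(1) unfolding linearly_quasiordered_def r_def by simp
  moreover have "infinite y" if "y \<in> g ` X" for y
    using r[OF that] finite_subset by blast
  ultimately show "linearly_refinable (g ` X)"
    unfolding linearly_refinable_def by blast
qed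

lemma linearly_refinable_image_mono:
  assumes "linearly_refinable (g ` X)" and "\<And>x. x \<in> X \<Longrightarrow> g x \<subseteq> g' x"
  shows "linearly_refinable (g' ` X)"
  using assms unfolding linearly_refinable_image_iff by (meson subset_trans)

lemma linearly_quasiordered_image:
  assumes "linearly_quasiordered Y"
  shows "linearly_quasiordered ((`) p ` Y)"
proof -
  have "p ` a \<subseteq>* p ` b" if "a \<subseteq>* b" for a b
    using that finite_subset[OF image_diff_subset finite_imageI] by (simp add: almost_subset_def)
  then show ?thesis
    using assms unfolding linearly_quasiordered_def by blast
qed

text \<open>Taking images under \<open>p\<close> preserves almost inclusion, and injectivity keeps
  the images of the refinements infinite. This serves to pass from the enumeration of a cover back
  to the original indices.\<close>

lemma linearly_refinable_inj_image:
  assumes "linearly_refinable (g ` X)" and "inj p" and "\<And>x. x \<in> X \<Longrightarrow> p ` g x \<subseteq> g' x"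
  shows "linearly_refinable (g' ` X)"
proof -
  obtain s where s: "\<And>x. x \<in> X \<Longrightarrow> s x \<subseteq> g x \<and> infinite (s x)"
    and lin: "linearly_quasiordered (s ` X)"
    using assms(1) unfolding linearly_refinable_image_iff by blast
  have "p ` s x \<subseteq> g' x \<and> infinite (p ` s x)" if "x \<in> X" for x
    using s[OF that] assms(3)[OF that] \<open>inj p\<close>
    by (meson finite_imageD image_mono inj_on_subset subset_UNIV subset_trans)
  moreover have "linearly_quasiordered ((\<lambda>x. p ` s x) ` X)"
    using linearly_quasiordered_image[OF lin, of p] by (simp add: image_image)
  ultimately show ?thesis
    unfolding linearly_refinable_image_iff by (intro exI[of _ "\<lambda>x. p ` s x"]) simp
qed

section \<open>From the selection principle to continuous images\<close>

text \<open>The infinitude of the traces is already contained in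
  \<open>linearly_refinable\<close>.\<close>

lemma weak_excluded_middle_image_iff:
  "weak_excluded_middle (\<Psi> ` X) \<longleftrightarrow> (\<exists>h. linearly_refinable ((\<lambda>x. {n. \<Psi> x n \<le> h n}) ` X))"
  unfolding weak_excluded_middle_def image_image by (auto simp: linearly_refinable_def)

lemma weak_excluded_middle_if_infinitely_many_bounded:
  assumes "infinite {n. \<exists>m. \<forall>x\<in>X. \<Psi> x n \<le> m}" (is "infinite ?A")
  shows "weak_excluded_middle (\<Psi> ` X)"
proof -
  \<comment> \<open>On \<open>?A\<close>, \<open>h\<close> bounds the whole coordinate; elsewhere
    its values are arbitrary. Hence \<open>?A\<close> itself is a common refinement of all
    traces.\<close>
  obtain h where h: "\<And>n x. n \<in> ?A \<Longrightarrow> x \<in> X \<Longrightarrow> \<Psi> x n \<le> h n"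
    using bchoice[of ?A "\<lambda>n m. \<forall>x\<in>X. \<Psi> x n \<le> m"] by auto
  have "linearly_refinable ((\<lambda>x. {n. \<Psi> x n \<le> h n}) ` X)"
    unfolding linearly_refinable_image_iff
  proof (intro exI conjI ballI)
    show "?A \<subseteq> {n. \<Psi> x n \<le> h n}" if "x \<in> X" for x
      using h that by auto
    show "linearly_quasiordered ((\<lambda>x. ?A) ` X)"
      by (auto simp: linearly_quasiordered_def almost_subset_def)
  qed (rule assms)
  then show ?thesis
    unfolding weak_excluded_middle_image_iff by blast
qed

lemma Ufin_O_tau_star_imp_weak_excluded_middle:
  fixes X :: "'a::topological_space set" and \<Psi> :: "'a \<Rightarrow> nat \<Rightarrow> nat"
  assumes Ufin: "Ufin_O_tau_star X" and cont: "continuous_on X \<Psi>"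
  shows "weak_excluded_middle (\<Psi> ` X)"
proof (cases "infinite {n. \<exists>m. \<forall>x\<in>X. \<Psi> x n \<le> m}")
  case True
  then show ?thesis
    by (rule weak_excluded_middle_if_infinitely_many_bounded)
next
  case False
  then obtain N where N: "{n. \<exists>m. \<forall>x\<in>X. \<Psi> x n \<le> m} \<subseteq> {..<N}"
    using finite_nat_bounded by blast
  have unbdd: "\<exists>x\<in>X. m < \<Psi> x (N + n)" for n m
  proof (rule ccontr)
    assume "\<not> ?thesis"
    then have "N + n \<in> {n. \<exists>m. \<forall>x\<in>X. \<Psi> x n \<le> m}" by (auto simp: not_less)
    with N show False by auto
  qed
  \<comment> \<open>The shift by \<open>N\<close> skips every bounded coordinate, so no
    \<open>S n m\<close> is all of \<open>X\<close>.\<close>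
  define S where "S n m = {x \<in> X. \<Psi> x (N + n) \<le> m}" for n m
  have S_ne: "S n m \<noteq> X" for n m
  proof -
    obtain x where "x \<in> X" "m < \<Psi> x (N + n)" using unbdd by blast
    then have "x \<in> X - S n m" by (simp add: S_def)
    then show ?thesis by blast
  qed
  have S_open: "openin (top_of_set X) (S n m)" for n m
  proof -
    have "continuous_on X (\<lambda>x. \<Psi> x (N + n))"
      using cont by (rule continuous_on_product_then_coordinatewise)
    moreover have "S n m = X \<inter> (\<lambda>x. \<Psi> x (N + n)) -` {..m}"
      by (auto simp: S_def)
    ultimately show ?thesis
      by (simp add: continuous_openin_preimage_gen open_discrete)
  qed
  \<comment> \<open>The sets \<open>S n m\<close> increase with \<open>m\<close>, so a finite union
    of them lies in a single one.\<close>
  have bounded: "\<exists>m. \<Union>\<G> \<subseteq> S n m" if \<G>: "finite \<G>" "\<G> \<subseteq> range (S n)" for \<G> n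
  proof -
    obtain M where "finite M" "\<G> = S n ` M"
      using finite_subset_image[OF \<G>] by blast
    moreover obtain m where "M \<subseteq> {..<m}"
      using finite_nat_bounded[OF \<open>finite M\<close>] by blast
    ultimately have "\<Union>\<G> \<subseteq> S n m" by (force simp: S_def)
    then show ?thesis ..
  qed
  have "range (S n) \<in> countable_open_covers X" for n
  proof -
    have "\<Union>(range (S n)) = X" by (auto simp: S_def)
    moreover have "S n m \<subseteq> X" for m by (auto simp: S_def)
    ultimately show ?thesis
      using S_ne S_open by (auto simp: countable_open_covers_def cover_of_def dest: sym)
  qed
  moreover have "\<not> (\<exists>\<G>. finite \<G> \<and> \<G> \<subseteq> range (S n) \<and> \<Union>\<G> = X)" for n
  proof
    assume "\<exists>\<G>. finite \<G> \<and> \<G> \<subseteq> range (S n) \<and> \<Union>\<G> = X"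
    then obtain m where "X \<subseteq> S n m" using bounded by metis
    then show False using S_ne[of n m] by (auto simp: S_def)
  qed
  ultimately have "\<exists>\<F>. (\<forall>n. finite (\<F> n) \<and> \<F> n \<subseteq> range (S n)) \<and>
      range (\<lambda>n. \<Union>(\<F> n)) \<in> countable_open_tau_star_covers X"
    using Ufin unfolding Ufin_O_tau_star_def by (simp only: simp_thms)
  then obtain \<F> where fin: "\<And>n. finite (\<F> n)" and sub: "\<And>n. \<F> n \<subseteq> range (S n)"
    and tau: "range (\<lambda>n. \<Union>(\<F> n)) \<in> countable_open_tau_star_covers X"
    by blast
  obtain h where h: "\<And>n. \<Union>(\<F> n) \<subseteq> S n (h n)"
    using bounded[OF fin sub] by metis
  obtain e where e: "bij_betw e (UNIV :: nat set) (range (\<lambda>n. \<Union>(\<F> n)))"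
    and refinable: "linearly_refinable (point_trace e ` X)"
    using tau by (auto simp: countable_open_tau_star_covers_def tau_star_cover_of_def)
  have "\<exists>n. e k = \<Union>(\<F> n)" for k
    using bij_betwE[OF e] by blast
  \<comment> \<open>The enumeration \<open>e\<close> need not follow the order of the families, and
    different families may have the same union. \<open>p\<close> picks one family for each member;
    it is injective because \<open>e\<close> is.\<close>
  then obtain p where p: "\<And>k. e k = \<Union>(\<F> (p k))" by metis
  have "inj p"
    using bij_betw_imp_inj_on[OF e] p by (metis injD injI)
  then have inj: "inj (\<lambda>k. N + p k)" by (simp add: inj_def)
  \<comment> \<open>Subtracting \<open>N\<close> undoes the shift. Below \<open>N\<close> it
    truncates to \<open>h 0\<close>, which is harmless because the transported refinements only
    contain indices \<open>N + p k\<close>.\<close>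
  have "linearly_refinable ((\<lambda>x. {n. \<Psi> x n \<le> h (n - N)}) ` X)"
  proof (rule linearly_refinable_inj_image[OF refinable inj])
    show "(\<lambda>k. N + p k) ` point_trace e x \<subseteq> {n. \<Psi> x n \<le> h (n - N)}" for x
      using h p by (fastforce simp: point_trace_def S_def)
  qed
  then show ?thesis
    unfolding weak_excluded_middle_image_iff by (rule exI[of _ "\<lambda>n. h (n - N)"])
qed

section \<open>Clopen refinements and least-index maps\<close>

text \<open>Each point has a clopen neighbourhood inside a member of the cover, and the Lindelof
  property extracts countably many of these.\<close>

lemma zero_dimensional_countable_clopen_refinement:
  fixes X :: "'a::second_countable_topology set"
  assumes dim: "top_of_set X dim_le 0" and cover: "\<U> \<in> countable_open_covers X" and "X \<noteq> {}"
  obtains C :: "nat \<Rightarrow> 'a set"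
  where "\<And>k. openin (top_of_set X) (C k)" "\<And>k. closedin (top_of_set X) (C k)"
    "\<And>k. \<exists>U\<in>\<U>. C k \<subseteq> U" "(\<Union>k. C k) = X"
proof -
  define B where "B = {V. openin (top_of_set X) V \<and> closedin (top_of_set X) V \<and> (\<exists>U\<in>\<U>. V \<subseteq> U)}"
  have "\<Union>B = X"
  proof
    show "\<Union>B \<subseteq> X"
      by (intro Union_least) (auto simp: B_def dest: openin_imp_subset)
    show "X \<subseteq> \<Union>B"
    proof
      fix x assume "x \<in> X"
      then obtain U where U: "U \<in> \<U>" "x \<in> U" "openin (top_of_set X) U"
        using cover by (auto simp: countable_open_covers_def cover_of_def)
      then obtain V where "openin (top_of_set X) V" "closedin (top_of_set X) V" "x \<in> V" "V \<subseteq> U"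
        using dim unfolding dim_le_0_iff_clopen_base by metis
      with U show "x \<in> \<Union>B" by (auto simp: B_def)
    qed
  qed
  moreover obtain B' where B': "B' \<subseteq> B" "countable B'" "\<Union>B' = \<Union>B"
    using Lindelof_openin[of B X] by (auto simp: B_def)
  \<comment> \<open>\<open>from_nat_into\<close> enumerates a nonempty countable set, possibly with
    repetitions.\<close>
  ultimately have "B' \<noteq> {}" using \<open>X \<noteq> {}\<close> by auto
  then have range: "range (from_nat_into B') = B'"
    using B'(2) by (rule range_from_nat_into)
  show thesis
  proof (rule that)
    have "from_nat_into B' k \<in> B" for k
      using range B'(1) by blast
    then show "openin (top_of_set X) (from_nat_into B' k)"
      "closedin (top_of_set X) (from_nat_into B' k)" "\<exists>U\<in>\<U>. from_nat_into B' k \<subseteq> U" for k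
      by (auto simp: B_def)
    show "\<Union>(range (from_nat_into B')) = X"
      using range B'(3) \<open>\<Union>B = X\<close> by simp
  qed
qed

text \<open>The fibre over \<open>m\<close> is \<open>C m\<close> minus finitely many earlier clopen
  sets, hence open; so the map is locally constant.\<close>

lemma continuous_on_Least_clopen_cover:
  fixes C :: "nat \<Rightarrow> 'a::topological_space set"
  assumes op: "\<And>k. openin (top_of_set X) (C k)" and cl: "\<And>k. closedin (top_of_set X) (C k)"
    and cover: "X \<subseteq> (\<Union>k. C k)"
  shows "continuous_on X (\<lambda>x. LEAST k. x \<in> C k)" (is "continuous_on X ?f")
proof -
  have fibre: "openin (top_of_set X) (X \<inter> ?f -` {m})" for m
  proof -
    have "X \<inter> ?f -` {m} = C m - (\<Union>k<m. C k)"
    proof (intro set_eqI iffI)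
      fix x assume x: "x \<in> X \<inter> ?f -` {m}"
      then obtain k where "x \<in> C k" using cover by blast
      then have "x \<in> C (?f x)" by (rule LeastI)
      then show "x \<in> C m - (\<Union>k<m. C k)" using x not_less_Least by auto
    next
      fix x assume "x \<in> C m - (\<Union>k<m. C k)"
      moreover from this have "?f x = m"
        by (intro Least_equality) (auto simp: not_le[symmetric])
      ultimately show "x \<in> X \<inter> ?f -` {m}"
        using openin_imp_subset[OF op] by auto
    qed
    moreover have "closedin (top_of_set X) (\<Union>k<m. C k)"
      using cl by (intro closedin_Union) auto
    ultimately show ?thesis
      using openin_diff[OF op] by simp
  qed
  have "openin (top_of_set X) (X \<inter> ?f -` T)" for T
  proof -
    have "openin (top_of_set X) (\<Union>m\<in>T. X \<inter> ?f -` {m})"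
      using fibre by (intro openin_Union) auto
    moreover have "(\<Union>m\<in>T. X \<inter> ?f -` {m}) = X \<inter> ?f -` T" by auto
    ultimately show ?thesis by simp
  qed
  then show ?thesis
    by (simp add: continuous_openin_preimage_eq)
qed

section \<open>From continuous images to the selection principle\<close>

text \<open>None of the finitely many earlier unions is \<open>X\<close>, so each omits a point of
  some member of the current cover. Adding one such member for each earlier union makes the new
  union different from all of them.\<close>

lemma finite_subfamilies_with_distinct_unions:
  fixes \<U> :: "nat \<Rightarrow> 'a set set"
  assumes cover: "\<And>n. \<Union>(\<U> n) = X"
    and nofin: "\<And>n \<G>. finite \<G> \<Longrightarrow> \<G> \<subseteq> \<U> n \<Longrightarrow> \<Union>\<G> \<noteq> X"
    and \<E>: "\<And>n. finite (\<E> n)" "\<And>n. \<E> n \<subseteq> \<U> n"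
  obtains \<F> where "\<And>n. finite (\<F> n)" "\<And>n. \<E> n \<subseteq> \<F> n" "\<And>n. \<F> n \<subseteq> \<U> n" "inj (\<lambda>n. \<Union>(\<F> n))"
proof -
  have ext: "\<exists>\<G>. finite \<G> \<and> \<E> n \<subseteq> \<G> \<and> \<G> \<subseteq> \<U> n \<and> (\<forall>V\<in>\<V>. \<not> \<Union>\<G> \<subseteq> V)"
    if "finite \<V>" "\<And>V. V \<in> \<V> \<Longrightarrow> \<not> X \<subseteq> V" for n \<V>
  proof -
    have "\<exists>U. U \<in> \<U> n \<and> \<not> U \<subseteq> V" if "V \<in> \<V>" for V
      using cover[of n] \<open>\<And>V. V \<in> \<V> \<Longrightarrow> \<not> X \<subseteq> V\<close>[OF that] by blast
    then obtain u where "\<And>V. V \<in> \<V> \<Longrightarrow> u V \<in> \<U> n \<and> \<not> u V \<subseteq> V" by metis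
    then have "u ` \<V> \<subseteq> \<U> n" "\<forall>V\<in>\<V>. \<not> \<Union>(\<E> n \<union> u ` \<V>) \<subseteq> V" by blast+
    then show ?thesis
      using \<E>[of n] \<open>finite \<V>\<close> by (intro exI[of _ "\<E> n \<union> u ` \<V>"]) simp
  qed
  define P where "P n \<G> \<longleftrightarrow> finite \<G> \<and> \<E> n \<subseteq> \<G> \<and> \<G> \<subseteq> \<U> n" for n \<G>
  have "\<exists>\<F>. \<forall>n. P n (\<F> n) \<and> (\<forall>i<n. \<not> \<Union>(\<F> n) \<subseteq> \<Union>(\<F> i))"
  proof (rule dependent_wellorder_choice)
    show "\<exists>\<G>. P n \<G> \<and> (\<forall>i<n. \<not> \<Union>\<G> \<subseteq> \<Union>(\<F> i))"
      if "\<And>m. m < n \<Longrightarrow> P m (\<F> m) \<and> (\<forall>i<m. \<not> \<Union>(\<F> m) \<subseteq> \<Union>(\<F> i))" for n \<F>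
    proof -
      have "\<not> X \<subseteq> V" if V: "V \<in> (\<lambda>i. \<Union>(\<F> i)) ` {..<n}" for V
      proof -
        obtain i where i: "i < n" "V = \<Union>(\<F> i)" using V by auto
        then have "finite (\<F> i)" "\<F> i \<subseteq> \<U> i"
          using \<open>\<And>m. m < n \<Longrightarrow> P m (\<F> m) \<and> (\<forall>i<m. \<not> \<Union>(\<F> m) \<subseteq> \<Union>(\<F> i))\<close> by (auto simp: P_def)
        then show ?thesis
          using nofin[of "\<F> i" i] cover[of i] i by blast
      qed
      then obtain \<G> where "finite \<G> \<and> \<E> n \<subseteq> \<G> \<and> \<G> \<subseteq> \<U> n \<and> (\<forall>V\<in>(\<lambda>i. \<Union>(\<F> i)) ` {..<n}. \<not> \<Union>\<G> \<subseteq> V)"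
        using ext[of "(\<lambda>i. \<Union>(\<F> i)) ` {..<n}" n] by blast
      then show ?thesis by (intro exI[of _ \<G>]) (simp add: P_def)
    qed
  qed auto
  then obtain \<F> where \<F>: "\<And>n. P n (\<F> n)" "\<And>i n. i < n \<Longrightarrow> \<not> \<Union>(\<F> n) \<subseteq> \<Union>(\<F> i)" by blast
  have "inj (\<lambda>n. \<Union>(\<F> n))"
    using \<F>(2) by (intro linorder_injI) (metis subset_refl)
  with \<F>(1) show thesis
    by (intro that[of \<F>]) (simp_all add: P_def)
qed

lemma weak_excluded_middle_imp_Ufin_O_tau_star:
  fixes X :: "'a::second_countable_topology set"
  assumes dim: "top_of_set X dim_le 0"
    and wem: "\<And>\<Psi> :: 'a \<Rightarrow> nat \<Rightarrow> nat. continuous_on X \<Psi> \<Longrightarrow> weak_excluded_middle (\<Psi> ` X)"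
  shows "Ufin_O_tau_star X"
  unfolding Ufin_O_tau_star_def
proof (intro allI impI, elim conjE)
  fix \<U> :: "nat \<Rightarrow> 'a set set"
  assume \<U>: "\<forall>n. \<U> n \<in> countable_open_covers X"
    and "\<forall>n. \<not> (\<exists>\<G>. finite \<G> \<and> \<G> \<subseteq> \<U> n \<and> \<Union>\<G> = X)"
  then have nofin: "\<And>n \<G>. finite \<G> \<Longrightarrow> \<G> \<subseteq> \<U> n \<Longrightarrow> \<Union>\<G> \<noteq> X" by blast
  have "X \<noteq> {}" using nofin[of "{}" 0] by auto
  have cover: "\<And>n. \<Union>(\<U> n) = X" and op: "\<And>n U. U \<in> \<U> n \<Longrightarrow> openin (top_of_set X) U"
    using \<U> by (auto simp: countable_open_covers_def cover_of_def)
  have "\<exists>C :: nat \<Rightarrow> 'a set. (\<forall>k. openin (top_of_set X) (C k) \<and> closedin (top_of_set X) (C k) \<and>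
      (\<exists>U\<in>\<U> n. C k \<subseteq> U)) \<and> (\<Union>k. C k) = X" for n
    using zero_dimensional_countable_clopen_refinement[OF dim \<U>[rule_format, of n] \<open>X \<noteq> {}\<close>]
    by metis
  then obtain C :: "nat \<Rightarrow> nat \<Rightarrow> 'a set"
    where C: "\<And>n k. openin (top_of_set X) (C n k)" "\<And>n k. closedin (top_of_set X) (C n k)"
      "\<And>n k. \<exists>U\<in>\<U> n. C n k \<subseteq> U" "\<And>n. (\<Union>k. C n k) = X"
    by metis
  obtain u where u: "\<And>n k. u n k \<in> \<U> n" "\<And>n k. C n k \<subseteq> u n k"
    using C(3) by metis
  \<comment> \<open>The least index makes each coordinate continuous, as the sets
    \<open>C n k\<close> are clopen.\<close>
  define \<Psi> where "\<Psi> x n = (LEAST k. x \<in> C n k)" for x n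
  have \<Psi>: "x \<in> C n (\<Psi> x n)" if "x \<in> X" for x n
  proof -
    obtain k where "x \<in> C n k" using C(4)[of n] \<open>x \<in> X\<close> by blast
    then show ?thesis unfolding \<Psi>_def by (rule LeastI)
  qed
  have "continuous_on X \<Psi>"
    unfolding \<Psi>_def
    by (intro continuous_on_coordinatewise_then_product continuous_on_Least_clopen_cover C)
      (simp add: C(4))
  then obtain h where h: "linearly_refinable ((\<lambda>x. {n. \<Psi> x n \<le> h n}) ` X)"
    using wem weak_excluded_middle_image_iff by blast
  \<comment> \<open>The members \<open>u n k\<close> with \<open>k \<le> h n\<close> cover all
    points with \<open>\<Psi> x n \<le> h n\<close>; enlarging these families only enlarges
    traces.\<close>
  obtain \<F> where \<F>: "\<And>n. finite (\<F> n)" "\<And>n. u n ` {..h n} \<subseteq> \<F> n" "\<And>n. \<F> n \<subseteq> \<U> n"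
    and inj: "inj (\<lambda>n. \<Union>(\<F> n))"
  proof (rule finite_subfamilies_with_distinct_unions[of \<U> X "\<lambda>n. u n ` {..h n}"])
    show "u n ` {..h n} \<subseteq> \<U> n" for n
      using u(1) by blast
  qed (use cover nofin in auto)
  define e where "e n = \<Union>(\<F> n)" for n
  have inj_e: "inj e" using inj by (simp add: e_def[abs_def])
  have sub: "e n \<subseteq> X" for n
    using \<F>(3)[of n] cover[of n] unfolding e_def by blast
  have ne: "X \<noteq> e n" for n
    using nofin[OF \<F>(1,3)] unfolding e_def by (rule not_sym)
  have "{n. \<Psi> x n \<le> h n} \<subseteq> point_trace e x" if "x \<in> X" for x
  proof
    fix n assume "n \<in> {n. \<Psi> x n \<le> h n}"
    then have "u n (\<Psi> x n) \<in> \<F> n" using \<F>(2)[of n] by auto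
    moreover have "x \<in> u n (\<Psi> x n)" using \<Psi>[OF that] u(2) by blast
    ultimately show "n \<in> point_trace e x" by (auto simp: point_trace_def e_def)
  qed
  then have refinable: "linearly_refinable (point_trace e ` X)"
    by (rule linearly_refinable_image_mono[OF h])
  then have inf: "infinite (point_trace e x)" if "x \<in> X" for x
    using that by (simp add: linearly_refinable_def)
  \<comment> \<open>Injectivity of \<open>e\<close> turns infinitely many indices into infinitely
    many members.\<close>
  have "infinite {U \<in> range e. x \<in> U}" if "x \<in> X" for x
  proof -
    have "{U \<in> range e. x \<in> U} = e ` point_trace e x"
      by (auto simp: point_trace_def)
    then show ?thesis
      using inf[OF that] inj_on_subset[OF inj_e subset_UNIV] by (simp add: finite_image_iff)
  qed
  moreover have "X \<subseteq> \<Union>(range e)"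
  proof
    fix x assume "x \<in> X"
    then have "point_trace e x \<noteq> {}" using inf by force
    then show "x \<in> \<Union>(range e)" by (auto simp: point_trace_def)
  qed
  moreover have "X \<notin> range e"
    using ne by blast
  ultimately have "large_cover_of X (range e)"
    using sub by (simp add: large_cover_of_def cover_of_def subset_antisym UN_least)
  moreover have "bij_betw e UNIV (range e)"
    using inj_e by (simp add: bij_betw_def)
  moreover have "openin (top_of_set X) (e n)" for n
    using op subsetD[OF \<F>(3)[of n]] unfolding e_def by (intro openin_Union) metis
  ultimately have "range e \<in> countable_open_tau_star_covers X"
    using refinable by (auto simp: countable_open_tau_star_covers_def tau_star_cover_of_def)
  then show "\<exists>\<F>. (\<forall>n. finite (\<F> n) \<and> \<F> n \<subseteq> \<U> n) \<and>
      range (\<lambda>n. \<Union>(\<F> n)) \<in> countable_open_tau_star_covers X"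
    using \<F>(1,3) unfolding e_def by (intro exI[of _ \<F>]) simp
qed

theorem theorem7p8:
  fixes X :: "real set"
  assumes "infinite X"
    and "top_of_set X dim_le 0"
  shows "Ufin_O_tau_star X \<longleftrightarrow>
    (\<forall>\<Psi> :: real \<Rightarrow> nat \<Rightarrow> nat. continuous_on X \<Psi> \<longrightarrow> weak_excluded_middle (\<Psi> ` X))"
  using Ufin_O_tau_star_imp_weak_excluded_middle weak_excluded_middle_imp_Ufin_O_tau_star[OF assms(2)]
  by blast

end
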